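(* The free group $\mathbb F_2$ on two generators, with the word length metric, satisfies property (I).
   Context: Let $X=\Gamma$ be a finitely generated group with the (left-invariant) word length metric $d_X(x,y)=|x^{-1}y|$ with respect to a finite generating set; for $\mathbb F_2$ the generating set consists of the two free generators. For $x\in X$ and $Y\subset X$, $d_X(x,Y)=\inf_{y\in Y}d_X(x,y)$. The group $\Gamma$ satisfies property (I) if there are subsets $Y,Z\subset X$ such that: (i1) $X=Y\sqcup Z$, and for any $D>0$ there exists $z\in Z$ such that $d_X(z,Y)>D$; (i2) there exist $g,h\in\Gamma$ such that $gY\subset Y$, $hZ\subset Y$ and $gY\cap hZ=\emptyset$; (i3) for these $g,h$ there exists $C>0$ such that $|d_X(gy,hz)-d_X(y,z)|<C$ for any $y\in Y$, $z\in Z$. *)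

theory Defs
  imports Complex_Main "HOL-Algebra.Generated_Groups"
begin

section \<open>Word metrics and property (I)\<close>

text \<open>Meaningful for \<open>x\<close> in the subgroup generated by \<open>S\<close>; otherwise the set of
  candidate lengths is empty.\<close>
definition word_length :: "('a, 'b) monoid_scheme \<Rightarrow> 'a set \<Rightarrow> 'a \<Rightarrow> nat" where
  "word_length G S x =
     (LEAST n. \<exists>ws. length ws = n \<and> set ws \<subseteq> S \<union> m_inv G ` S \<and>
        foldr (\<otimes>\<^bsub>G\<^esub>) ws \<one>\<^bsub>G\<^esub> = x)"

definition word_dist :: "('a, 'b) monoid_scheme \<Rightarrow> 'a set \<Rightarrow> 'a \<Rightarrow> 'a \<Rightarrow> real" where
  "word_dist G S x y = real (word_length G S (inv\<^bsub>G\<^esub> x \<otimes>\<^bsub>G\<^esub> y))"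

text \<open>The real infimum over the empty set is a junk value. In property (I) below this case
  does not arise: the first condition gives \<open>Z \<noteq> {}\<close>, and then \<open>h Z \<subseteq> Y\<close>
  gives \<open>Y \<noteq> {}\<close>.\<close>
definition word_setdist :: "('a, 'b) monoid_scheme \<Rightarrow> 'a set \<Rightarrow> 'a \<Rightarrow> 'a set \<Rightarrow> real" where
  "word_setdist G S x Y = (INF y\<in>Y. word_dist G S x y)"

text \<open>The standing assumption that \<open>S\<close> is a finite generating set of the group \<open>G\<close> is
  part of the definition.\<close>
definition property_I :: "('a, 'b) monoid_scheme \<Rightarrow> 'a set \<Rightarrow> bool" where
  "property_I G S \<longleftrightarrow>
     group G \<and> finite S \<and> S \<subseteq> carrier G \<and> generate G S = carrier G \<and>
     (\<exists>Y Z. carrier G = Y \<union> Z \<and> Y \<inter> Z = {} \<and>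
        (\<forall>D>0. \<exists>z\<in>Z. word_setdist G S z Y > D) \<and>
        (\<exists>g\<in>carrier G. \<exists>h\<in>carrier G.
           g <#\<^bsub>G\<^esub> Y \<subseteq> Y \<and> h <#\<^bsub>G\<^esub> Z \<subseteq> Y \<and> (g <#\<^bsub>G\<^esub> Y) \<inter> (h <#\<^bsub>G\<^esub> Z) = {} \<and>
           (\<exists>C>0. \<forall>y\<in>Y. \<forall>z\<in>Z.
              \<bar>word_dist G S (g \<otimes>\<^bsub>G\<^esub> y) (h \<otimes>\<^bsub>G\<^esub> z) - word_dist G S y z\<bar> < C)))"

section \<open>The free group on two generators\<close>

text \<open>The free group on a type of generators, realised as reduced words. The letter
  \<open>(s, True)\<close> stands for the generator \<open>s\<close> and \<open>(s, False)\<close> for its formal inverse.\<close>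

definition flip_letter :: "'s \<times> bool \<Rightarrow> 's \<times> bool" where
  "flip_letter l = (fst l, \<not> snd l)"

definition reduced_word :: "('s \<times> bool) list \<Rightarrow> bool" where
  "reduced_word = successively (\<lambda>l m. m \<noteq> flip_letter l)"

fun push_letter :: "'s \<times> bool \<Rightarrow> ('s \<times> bool) list \<Rightarrow> ('s \<times> bool) list" where
  "push_letter l [] = [l]"
| "push_letter l (m # w) = (if m = flip_letter l then w else l # m # w)"

definition reduce_word :: "('s \<times> bool) list \<Rightarrow> ('s \<times> bool) list" where
  "reduce_word w = foldr push_letter w []"

definition free_group :: "('s \<times> bool) list monoid" where
  "free_group = \<lparr>carrier = {w. reduced_word w}, mult = (\<lambda>u v. reduce_word (u @ v)), one = []\<rparr>"

datatype gen2 = Gen_a | Gen_b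

abbreviation F2 :: "(gen2 \<times> bool) list monoid" where
  "F2 \<equiv> free_group"

definition F2_gens :: "(gen2 \<times> bool) list set" where
  "F2_gens = {[(Gen_a, True)], [(Gen_b, True)]}"

end

theory Submission
  imports Defs
begin

text \<open>Let \<open>Z\<close> be the set of reduced words starting with the generator \<open>a\<close> and \<open>Y\<close> its
  complement. A word in \<open>Y\<close> and a word in \<open>Z\<close> have no common prefix, so their distance is the sum
  of their lengths; in particular \<open>a\<^sup>n\<close> is at distance at least \<open>n\<close> from \<open>Y\<close>. Left multiplication by
  \<open>g = a\<^sup>-\<^sup>1\<close> on \<open>Y\<close> and by \<open>h = b\<close> on \<open>Z\<close> causes no cancellation, so the images start with different
  letters and \<open>d(g y, h z) = d(y, z) + 2\<close>.\<close>

section \<open>Reduced words form a group\<close>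

lemma flip_letter_flip [simp]: "flip_letter (flip_letter l) = l"
  by (simp add: flip_letter_def)

lemma flip_letter_eq_iff: "flip_letter l = m \<longleftrightarrow> l = flip_letter m"
  by auto

lemma reduced_word_Nil [simp]: "reduced_word []"
  by (simp add: reduced_word_def)

lemma reduced_word_Cons:
  "reduced_word (l # w) \<longleftrightarrow> (w = [] \<or> hd w \<noteq> flip_letter l) \<and> reduced_word w"
  by (cases w) (auto simp: reduced_word_def)

lemma push_letter_reduced: "reduced_word (l # w) \<Longrightarrow> push_letter l w = l # w"
  by (cases w) (auto simp: reduced_word_Cons)

lemma reduced_word_push_letter: "reduced_word w \<Longrightarrow> reduced_word (push_letter l w)"
  by (cases w) (auto simp: reduced_word_Cons)

text \<open>If \<open>w\<close> starts with \<open>l\<close>, the inner push deletes that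
  \<open>l\<close>. Since \<open>w\<close> is reduced, the remaining tail does not start with
  \<open>flip_letter l\<close>, so the outer push puts \<open>l\<close> back.\<close>

lemma push_letter_cancel:
  "reduced_word w \<Longrightarrow> push_letter l (push_letter (flip_letter l) w) = w"
  by (cases w) (auto simp: reduced_word_Cons push_letter_reduced)

lemma length_push_letter: "length (push_letter l w) \<le> Suc (length w)"
  by (cases w) auto

lemma reduced_word_foldr_push_letter:
  "reduced_word v \<Longrightarrow> reduced_word (foldr push_letter u v)"
  by (induction u) (auto intro: reduced_word_push_letter)

lemma reduced_word_reduce_word: "reduced_word (reduce_word w)"
  by (simp add: reduce_word_def reduced_word_foldr_push_letter)

lemma reduce_word_reduced: "reduced_word w \<Longrightarrow> reduce_word w = w"
  by (induction w) (auto simp: reduce_word_def push_letter_reduced reduced_word_Cons)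

text \<open>Only the case where \<open>w\<close> starts with \<open>flip_letter l\<close> needs
  work: there the right side pushes \<open>flip_letter l\<close> and then \<open>l\<close> onto a
  reduced word, and the two cancel.\<close>

lemma foldr_push_letter_push_letter:
  assumes "reduced_word v"
  shows "foldr push_letter (push_letter l w) v = push_letter l (foldr push_letter w v)"
  using push_letter_cancel[OF reduced_word_foldr_push_letter[OF assms]]
  by (cases w) auto

text \<open>Words act on reduced words by successive pushes, and this action depends only on the
  reduced form of the acting word. This is what makes the product associative.\<close>

lemma foldr_push_letter_reduce_word:
  "reduced_word v \<Longrightarrow> foldr push_letter (reduce_word u) v = foldr push_letter u v"
  by (induction u) (auto simp: reduce_word_def foldr_push_letter_push_letter)

lemma reduce_word_append_reduce_word:
  "reduce_word (reduce_word u @ v) = reduce_word (u @ v)"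
  "reduce_word (u @ reduce_word v) = reduce_word (u @ v)"
proof -
  have *: "reduce_word (u @ v) = foldr push_letter u (reduce_word v)" for u v :: "('a \<times> bool) list"
    by (simp add: reduce_word_def)
  show "reduce_word (reduce_word u @ v) = reduce_word (u @ v)"
    by (simp add: * foldr_push_letter_reduce_word reduced_word_reduce_word)
  show "reduce_word (u @ reduce_word v) = reduce_word (u @ v)"
    by (simp add: * reduce_word_reduced reduced_word_reduce_word)
qed

definition inv_word :: "('s \<times> bool) list \<Rightarrow> ('s \<times> bool) list" where
  "inv_word w = rev (map flip_letter w)"

lemma length_inv_word [simp]: "length (inv_word w) = length w"
  by (simp add: inv_word_def)

lemma last_inv_word: "w \<noteq> [] \<Longrightarrow> last (inv_word w) = flip_letter (hd w)"
  by (simp add: inv_word_def last_rev hd_map)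

text \<open>As \<open>flip_letter\<close> is an involution, the condition on neighbouring letters is
  symmetric and survives both the flip and the reversal.\<close>

lemma reduced_inv_word: "reduced_word w \<Longrightarrow> reduced_word (inv_word w)"
  unfolding reduced_word_def inv_word_def successively_rev successively_map
  by (simp add: eq_commute flip_letter_eq_iff)

lemma reduce_inv_word_append: "reduce_word (inv_word w @ w) = []"
proof (induction w)
  case (Cons l w)
  \<comment> \<open>In \<open>inv_word (l # w) @ l # w\<close> the letters
    \<open>flip_letter l\<close> and \<open>l\<close> meet in the middle; removing this pair leaves
    the word of the induction hypothesis.\<close>
  have "push_letter (flip_letter l) (push_letter l (reduce_word w)) = reduce_word w"
    using push_letter_cancel[OF reduced_word_reduce_word, of "flip_letter l" w] by simp
  then have "reduce_word (inv_word (l # w) @ l # w) = reduce_word (inv_word w @ w)"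
    by (simp add: inv_word_def reduce_word_def)
  with Cons.IH show ?case by simp
qed (simp add: inv_word_def reduce_word_def)

lemma free_group_simps:
  "carrier free_group = {w. reduced_word w}"
  "u \<otimes>\<^bsub>free_group\<^esub> v = reduce_word (u @ v)"
  "\<one>\<^bsub>free_group\<^esub> = []"
  by (simp_all add: free_group_def)

lemma group_free_group: "group free_group"
proof (rule groupI)
  fix w :: "('s \<times> bool) list"
  assume "w \<in> carrier free_group"
  then show "\<exists>v\<in>carrier free_group. v \<otimes>\<^bsub>free_group\<^esub> w = \<one>\<^bsub>free_group\<^esub>"
    by (intro bexI[of _ "inv_word w"])
       (simp_all add: free_group_simps reduced_inv_word reduce_inv_word_append)
qed (simp_all add: free_group_simps reduced_word_reduce_word reduce_word_reduced
      reduce_word_append_reduce_word)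

lemma inv_free_group: "reduced_word w \<Longrightarrow> inv\<^bsub>free_group\<^esub> w = inv_word w"
  by (intro group.inv_equality[OF group_free_group])
     (simp_all add: free_group_simps reduced_inv_word reduce_inv_word_append)

section \<open>The word metric of the standard generators\<close>

abbreviation free_gens :: "('s \<times> bool) list set" where
  "free_gens \<equiv> range (\<lambda>s. [(s, True)])"

lemma inv_letter: "inv\<^bsub>free_group\<^esub> [l] = [flip_letter l]"
  by (simp add: inv_free_group inv_word_def reduced_word_Cons)

lemma free_gens_Un_inv: "free_gens \<union> m_inv free_group ` free_gens = range (\<lambda>l. [l])"
proof -
  have letter: "[(s, b)] \<in> free_gens \<union> m_inv free_group ` free_gens" for s :: 's and b
    by (cases b) (auto simp: inv_letter flip_letter_def image_iff)
  show ?thesis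
  proof
    show "range (\<lambda>l. [l]) \<subseteq> free_gens \<union> m_inv free_group ` (free_gens :: ('s \<times> bool) list set)"
      using letter by (metis image_subsetI surj_pair)
  qed (auto simp: inv_letter)
qed

lemma foldr_mult_letters:
  "foldr (\<otimes>\<^bsub>free_group\<^esub>) (map (\<lambda>l. [l]) w) \<one>\<^bsub>free_group\<^esub> = reduce_word w"
proof (induction w)
  case (Cons l w)
  then show ?case
    using reduce_word_append_reduce_word(2)[of "[l]" w] by (simp add: free_group_simps)
qed (simp add: free_group_simps reduce_word_def)

lemma length_reduce_word: "length (reduce_word w) \<le> length w"
proof (induction w)
  case (Cons l w)
  then show ?case
    using length_push_letter[of l "reduce_word w"] by (simp add: reduce_word_def)
qed (simp add: reduce_word_def)

text \<open>Spelling \<open>w\<close> letter by letter attains its length. No shorter product works,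
  because a product of letters is the reduction of their list, and reduction never lengthens a
  word.\<close>

lemma word_length_free_group:
  assumes "reduced_word w"
  shows "word_length free_group free_gens w = length w"
  unfolding word_length_def free_gens_Un_inv
proof (rule Least_equality)
  show "\<exists>ws. length ws = length w \<and> set ws \<subseteq> range (\<lambda>l. [l]) \<and>
      foldr (\<otimes>\<^bsub>free_group\<^esub>) ws \<one>\<^bsub>free_group\<^esub> = w"
    by (rule exI[of _ "map (\<lambda>l. [l]) w"])
       (auto simp: foldr_mult_letters reduce_word_reduced assms)
next
  fix n
  assume "\<exists>ws. length ws = n \<and> set ws \<subseteq> range (\<lambda>l. [l]) \<and>
      foldr (\<otimes>\<^bsub>free_group\<^esub>) ws \<one>\<^bsub>free_group\<^esub> = w"
  then obtain ws where ws: "length ws = n" "set ws \<subseteq> range (\<lambda>l. [l])"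
      "foldr (\<otimes>\<^bsub>free_group\<^esub>) ws \<one>\<^bsub>free_group\<^esub> = w"
    by blast
  from ws(2) obtain u where "ws = map (\<lambda>l. [l]) u"
    by (metis ex_map_conv rangeE subset_code(1))
  with ws show "length w \<le> n"
    using foldr_mult_letters[of u] length_reduce_word[of u] by simp
qed

lemma generate_free_gens: "generate free_group free_gens = carrier free_group"
proof
  interpret group "free_group :: ('s \<times> bool) list monoid"
    by (rule group_free_group)
  show "generate free_group free_gens \<subseteq> carrier (free_group :: ('s \<times> bool) list monoid)"
    by (rule generate_incl) (auto simp: free_group_simps reduced_word_Cons)
  have letter: "[l] \<in> generate free_group free_gens" for l :: "'s \<times> bool"
  proof -
    have "[l] \<in> free_gens \<union> m_inv free_group ` free_gens"
      unfolding free_gens_Un_inv by simp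
    then show ?thesis
      by (metis UnE generate.incl generate.inv imageE)
  qed
  have "w \<in> generate free_group free_gens" if "reduced_word w" for w :: "('s \<times> bool) list"
    using that
  proof (induction w)
    case Nil
    show ?case
      using generate.one[of "free_group" free_gens] by (simp add: free_group_simps)
  next
    case (Cons l w)
    then have "[l] \<otimes>\<^bsub>free_group\<^esub> w \<in> generate free_group free_gens"
      by (intro generate.eng letter) (simp add: reduced_word_Cons)
    moreover have "[l] \<otimes>\<^bsub>free_group\<^esub> w = l # w"
      using Cons.prems by (simp add: free_group_simps reduce_word_reduced)
    ultimately show ?case by simp
  qed
  then show "carrier free_group \<subseteq> generate free_group (free_gens :: ('s \<times> bool) list set)"
    by (auto simp: free_group_simps)
qed

text \<open>The last letter of \<open>inv_word u\<close> is the flip of \<open>hd u\<close>, so it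
  could cancel against \<open>hd v\<close> only if the two heads agreed. Thus
  \<open>inv_word u @ v\<close> is already reduced and its length is the distance.\<close>

lemma word_dist_no_common_prefix:
  assumes "reduced_word u" "reduced_word v" "u = [] \<or> v = [] \<or> hd u \<noteq> hd v"
  shows "word_dist free_group free_gens u v = real (length u + length v)"
proof -
  have "reduced_word (inv_word u @ v)"
    using assms reduced_inv_word[OF assms(1)] last_inv_word[of u]
    by (cases "u = []") (auto simp: reduced_word_def successively_append_iff inv_word_def)
  then show ?thesis
    using assms
    by (simp add: word_dist_def inv_free_group free_group_simps reduce_word_reduced
        word_length_free_group)
qed

section \<open>Property (I)\<close>

lemma F2_gens_eq_free_gens: "F2_gens = free_gens"
  unfolding F2_gens_def using gen2.exhaust by auto

theorem lemma3p1: "property_I F2 F2_gens"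
proof -
  let ?a = "(Gen_a, True)" and ?b = "(Gen_b, True)"
  define Z where "Z = {w. reduced_word w \<and> w \<noteq> [] \<and> hd w = ?a}"
  define Y where "Y = {w. reduced_word w \<and> (w = [] \<or> hd w \<noteq> ?a)}"
  have dist: "word_dist F2 F2_gens u v = real (length u + length v)"
    if "reduced_word u" "reduced_word v" "u = [] \<or> v = [] \<or> hd u \<noteq> hd v" for u v
    using that word_dist_no_common_prefix by (simp add: F2_gens_eq_free_gens)
  have far: "\<exists>z\<in>Z. word_setdist F2 F2_gens z Y > D" for D
  proof -
    obtain n where n: "real n > D"
      using reals_Archimedean2 by blast
    \<comment> \<open>The exponent \<open>Suc n\<close> keeps \<open>z\<close> nonempty, hence in
      \<open>Z\<close>, even when \<open>n\<close> is 0.\<close>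
    define z where "z = replicate (Suc n) ?a"
    have reduced: "reduced_word (replicate k ?a)" for k
      by (induction k) (auto simp: reduced_word_Cons flip_letter_def)
    then have z: "z \<in> Z" "length z = Suc n"
      using reduced[of "Suc n"] by (simp_all add: z_def Z_def)
    have "real (Suc n) \<le> word_setdist F2 F2_gens z Y"
      unfolding word_setdist_def
    proof (rule cINF_greatest)
      show "Y \<noteq> {}"
        unfolding Y_def using reduced_word_Nil by blast
      fix y assume "y \<in> Y"
      then show "real (Suc n) \<le> word_dist F2 F2_gens z y"
        using z dist[of z y] by (auto simp: Y_def Z_def)
    qed
    with n z(1) show ?thesis by force
  qed
  define g where "g = [(Gen_a, False)]"
  define h where "h = [?b]"
  have gY: "reduced_word ((Gen_a, False) # y)" "g \<otimes>\<^bsub>F2\<^esub> y = (Gen_a, False) # y"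
    if "y \<in> Y" for y
  proof -
    show "reduced_word ((Gen_a, False) # y)"
      \<comment> \<open>The new letter could cancel only a leading \<open>?a\<close>, which no word
        of \<open>Y\<close> has.\<close>
      using that by (auto simp: Y_def reduced_word_Cons flip_letter_def)
    then show "g \<otimes>\<^bsub>F2\<^esub> y = (Gen_a, False) # y"
      by (simp add: g_def free_group_simps reduce_word_reduced)
  qed
  have hZ: "reduced_word (?b # z)" "h \<otimes>\<^bsub>F2\<^esub> z = ?b # z" if "z \<in> Z" for z
  proof -
    show "reduced_word (?b # z)"
      \<comment> \<open>Words of \<open>Z\<close> start with \<open>?a\<close>, so not with the
        inverse of \<open>?b\<close>.\<close>
      using that by (auto simp: Z_def reduced_word_Cons flip_letter_def)
    then show "h \<otimes>\<^bsub>F2\<^esub> z = ?b # z"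
      by (simp add: h_def free_group_simps reduce_word_reduced)
  qed
  have gY_img: "g <#\<^bsub>F2\<^esub> Y = (#) (Gen_a, False) ` Y"
    by (auto simp: l_coset_def gY)
  have hZ_img: "h <#\<^bsub>F2\<^esub> Z = (#) ?b ` Z"
    by (auto simp: l_coset_def hZ)
  have incl: "g <#\<^bsub>F2\<^esub> Y \<subseteq> Y" "h <#\<^bsub>F2\<^esub> Z \<subseteq> Y" "(g <#\<^bsub>F2\<^esub> Y) \<inter> (h <#\<^bsub>F2\<^esub> Z) = {}"
    unfolding gY_img hZ_img using gY(1) hZ(1) by (auto simp: Y_def)
  have shift: "\<bar>word_dist F2 F2_gens (g \<otimes>\<^bsub>F2\<^esub> y) (h \<otimes>\<^bsub>F2\<^esub> z) - word_dist F2 F2_gens y z\<bar> < 3"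
    if "y \<in> Y" "z \<in> Z" for y z
  proof -
    have "word_dist F2 F2_gens y z = real (length y + length z)"
      using that by (intro dist) (auto simp: Y_def Z_def)
    \<comment> \<open>The new heads \<open>(Gen_a, False)\<close> and \<open>?b\<close> differ, so
      lengths add up again, with one extra letter on each side. The difference is exactly 2, and 3
      serves as the strict bound.\<close>
    moreover have "word_dist F2 F2_gens (g \<otimes>\<^bsub>F2\<^esub> y) (h \<otimes>\<^bsub>F2\<^esub> z) =
        real (length y + length z) + 2"
      using that dist[OF gY(1) hZ(1)] by (simp add: gY hZ)
    ultimately show ?thesis by simp
  qed
  have gh: "g \<in> carrier F2" "h \<in> carrier F2"
    by (simp_all add: g_def h_def free_group_simps reduced_word_Cons)
  have gens: "finite F2_gens" "F2_gens \<subseteq> carrier F2"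
    by (auto simp: F2_gens_def free_group_simps reduced_word_Cons)
  have partition: "carrier F2 = Y \<union> Z" "Y \<inter> Z = {}"
    by (auto simp: Y_def Z_def free_group_simps)
  have "\<exists>C>0. \<forall>y\<in>Y. \<forall>z\<in>Z.
      \<bar>word_dist F2 F2_gens (g \<otimes>\<^bsub>F2\<^esub> y) (h \<otimes>\<^bsub>F2\<^esub> z) - word_dist F2 F2_gens y z\<bar> < C"
    using shift by (intro exI[of _ 3]) simp
  moreover have "generate F2 F2_gens = carrier F2"
    unfolding F2_gens_eq_free_gens by (rule generate_free_gens)
  moreover have "\<forall>D>0. \<exists>z\<in>Z. word_setdist F2 F2_gens z Y > D"
    using far by simp
  ultimately show ?thesis
    unfolding property_I_def
    by (intro conjI exI[of _ Y] exI[of _ Z] bexI[of _ g] bexI[of _ h]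
        group_free_group gens partition incl gh)
qed

end
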